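(* If $(X, *, R_1, R_2)$ and $(Y, \triangleright, R'_1, R'_2)$ are isomorphic finite singquandles, then their singquandle polynomials coincide: $sqp(X) = sqp(Y)$.
   Context: A quandle is a set $X$ with a binary operation $*$ such that (i) $x*x=x$ for all $x\in X$; (ii) for all $y,z\in X$ there is a unique $x\in X$ with $x*y=z$, and this $x$ is denoted $z\,\bar{*}\,y$; (iii) $(x*y)*z=(x*z)*(y*z)$ for all $x,y,z\in X$. A singquandle (short for oriented singquandle) is a quadruple $(X,*,R_1,R_2)$ where $(X,* )$ is a quandle and $R_1,R_2:X\times X\to X$ are maps such that for all $a,b,c\in X$: $$R_1(a\bar{*}b,c)*b=R_1(a,c*b),$$ $$R_2(a\bar{*}b,c)=R_2(a,c*b)\bar{*}b,$$ $$(b\bar{*}R_1(a,c))*a=(b*R_2(a,c))\bar{*}c,$$ $$R_2(a,b)=R_1(b,a*b),$$ $$R_1(a,b)*R_2(a,b)=R_2(b,a*b).$$ A homomorphism of singquandles $(X,*,R_1,R_2)\to(Y,\triangleright,R'_1,R'_2)$ is a map $f:X\to Y$ with $f(x*y)=f(x)\triangleright f(y)$, $f(R_1(x,y))=R'_1(f(x),f(y))$ and $f(R_2(x,y))=R'_2(f(x),f(y))$ for all $x,y\in X$. An isomorphism is a bijective homomorphism, and two singquandles are isomorphic if there is an isomorphism between them. Let $(X,*,R_1,R_2)$ be a finite singquandle. For $x\in X$ define $$C^1(x)=\{y\in X \mid y*x=y\},\quad R^1(x)=\{y\in X\mid x*y=x\},$$ $$C^2(x)=\{y\in X \mid R_1(y,x)=y\},\quad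 R^2(x)=\{y\in X\mid R_1(x,y)=x\},$$ $$C^3(x)=\{y\in X \mid R_2(y,x)=y\},\quad R^3(x)=\{y\in X\mid R_2(x,y)=x\},$$ and $c^i(x)=|C^i(x)|$, $r^i(x)=|R^i(x)|$ for $i=1,2,3$. The singquandle polynomial of $X$ is the polynomial in the variables $s_1,t_1,s_2,t_2,s_3,t_3$ $$sqp(X)=\sum_{x\in X} s_1^{r^1(x)}t_1^{c^1(x)}s_2^{r^2(x)}t_2^{c^2(x)}s_3^{r^3(x)}t_3^{c^3(x)}.$$ *)

theory Defs
  imports "HOL-Algebra.Congruence" "HOL-Library.Poly_Mapping"
begin

record 'a quandle_struct = "'a partial_object" +
  quandle_op :: "'a \<Rightarrow> 'a \<Rightarrow> 'a" (infixl "\<star>\<index>" 70)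

record 'a singquandle_struct = "'a quandle_struct" +
  R1 :: "'a \<Rightarrow> 'a \<Rightarrow> 'a"
  R2 :: "'a \<Rightarrow> 'a \<Rightarrow> 'a"

locale quandle =
  fixes X (structure)
  assumes op_closed: "\<lbrakk>x \<in> carrier X; y \<in> carrier X\<rbrakk> \<Longrightarrow> x \<star> y \<in> carrier X"
    and idem: "x \<in> carrier X \<Longrightarrow> x \<star> x = x"
    and ex1_right_inverse:
      "\<lbrakk>y \<in> carrier X; z \<in> carrier X\<rbrakk> \<Longrightarrow> \<exists>!x. x \<in> carrier X \<and> x \<star> y = z"
    and self_distrib:
      "\<lbrakk>x \<in> carrier X; y \<in> carrier X; z \<in> carrier X\<rbrakk>
        \<Longrightarrow> (x \<star> y) \<star> z = (x \<star> z) \<star> (y \<star> z)"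

text \<open>The inverse operation is meaningful for arguments in the carrier of a quandle, where the
  element described exists and is unique.\<close>

definition quandle_bar ::
    "('a, 'b) quandle_struct_scheme \<Rightarrow> 'a \<Rightarrow> 'a \<Rightarrow> 'a" (infixl "\<diamondop>\<index>" 70)
  where "z \<diamondop>\<^bsub>X\<^esub> y = (THE x. x \<in> carrier X \<and> x \<star>\<^bsub>X\<^esub> y = z)"

locale singquandle = quandle X for X :: "('a, 'b) singquandle_struct_scheme" (structure) +
  assumes R1_closed: "\<lbrakk>a \<in> carrier X; b \<in> carrier X\<rbrakk> \<Longrightarrow> R1 X a b \<in> carrier X"
    and R2_closed: "\<lbrakk>a \<in> carrier X; b \<in> carrier X\<rbrakk> \<Longrightarrow> R2 X a b \<in> carrier X"
    and R1_slide:
      "\<lbrakk>a \<in> carrier X; b \<in> carrier X; c \<in> carrier X\<rbrakk>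
        \<Longrightarrow> R1 X (a \<diamondop> b) c \<star> b = R1 X a (c \<star> b)"
    and R2_slide:
      "\<lbrakk>a \<in> carrier X; b \<in> carrier X; c \<in> carrier X\<rbrakk>
        \<Longrightarrow> R2 X (a \<diamondop> b) c = R2 X a (c \<star> b) \<diamondop> b"
    and R1_R2_slide:
      "\<lbrakk>a \<in> carrier X; b \<in> carrier X; c \<in> carrier X\<rbrakk>
        \<Longrightarrow> (b \<diamondop> R1 X a c) \<star> a = (b \<star> R2 X a c) \<diamondop> c"
    and R2_eq_R1:
      "\<lbrakk>a \<in> carrier X; b \<in> carrier X\<rbrakk> \<Longrightarrow> R2 X a b = R1 X b (a \<star> b)"
    and R1_op_R2:
      "\<lbrakk>a \<in> carrier X; b \<in> carrier X\<rbrakk> \<Longrightarrow> R1 X a b \<star> R2 X a b = R2 X b (a \<star> b)"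

definition singquandle_hom ::
    "('a, 'm) singquandle_struct_scheme \<Rightarrow> ('b, 'n) singquandle_struct_scheme \<Rightarrow> ('a \<Rightarrow> 'b) set"
  where "singquandle_hom X Y =
    {f. f \<in> carrier X \<rightarrow> carrier Y \<and>
        (\<forall>x\<in>carrier X. \<forall>y\<in>carrier X.
           f (x \<star>\<^bsub>X\<^esub> y) = f x \<star>\<^bsub>Y\<^esub> f y \<and>
           f (R1 X x y) = R1 Y (f x) (f y) \<and>
           f (R2 X x y) = R2 Y (f x) (f y))}"

definition singquandle_iso ::
    "('a, 'm) singquandle_struct_scheme \<Rightarrow> ('b, 'n) singquandle_struct_scheme \<Rightarrow> ('a \<Rightarrow> 'b) set"
  where "singquandle_iso X Y =
    {f. f \<in> singquandle_hom X Y \<and> bij_betw f (carrier X) (carrier Y)}"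

definition singquandle_isomorphic ::
    "('a, 'm) singquandle_struct_scheme \<Rightarrow> ('b, 'n) singquandle_struct_scheme \<Rightarrow> bool"
  where "singquandle_isomorphic X Y \<longleftrightarrow> singquandle_iso X Y \<noteq> {}"

text \<open>Fixed-point counts of a binary operation \<open>g\<close> on a set \<open>A\<close>. For \<open>g\<close> equal to \<open>*\<close>, \<open>R\<^sub>1\<close>, \<open>R\<^sub>2\<close>
  and \<open>A\<close> the carrier they are \<open>c\<^sup>i(x)\<close> and \<open>r\<^sup>i(x)\<close> for \<open>i = 1, 2, 3\<close> respectively.\<close>

definition c_count :: "'a set \<Rightarrow> ('a \<Rightarrow> 'a \<Rightarrow> 'a) \<Rightarrow> 'a \<Rightarrow> nat"
  where "c_count A g x = card {y \<in> A. g y x = y}"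

definition r_count :: "'a set \<Rightarrow> ('a \<Rightarrow> 'a \<Rightarrow> 'a) \<Rightarrow> 'a \<Rightarrow> nat"
  where "r_count A g x = card {y \<in> A. g x y = x}"

datatype sqp_indet = S1 | T1 | S2 | T2 | S3 | T3

text \<open>Polynomials with integer coefficients in the six indeterminates: finitely supported maps from
  monomials (finitely supported exponent functions) to coefficients, with convolution as product.\<close>

type_synonym sqp_poly = "(sqp_indet \<Rightarrow>\<^sub>0 nat) \<Rightarrow>\<^sub>0 int"

definition indet :: "sqp_indet \<Rightarrow> sqp_poly"
  where "indet v = Poly_Mapping.single (Poly_Mapping.single v 1) 1"

definition sqp :: "('a, 'm) singquandle_struct_scheme \<Rightarrow> sqp_poly"
  where "sqp X = (\<Sum>x\<in>carrier X.
    indet S1 ^ r_count (carrier X) (quandle_op X) x * indet T1 ^ c_count (carrier X) (quandle_op X) x *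
    indet S2 ^ r_count (carrier X) (R1 X) x * indet T2 ^ c_count (carrier X) (R1 X) x *
    indet S3 ^ r_count (carrier X) (R2 X) x * indet T3 ^ c_count (carrier X) (R2 X) x)"

end

theory Submission
  imports Defs
begin

text \<open>
  The polynomial of a singquandle is a sum over its elements of a monomial whose exponents count
  the solutions of the equations \<open>g y x = y\<close> and \<open>g x y = x\<close>, where \<open>g\<close> is one of the three
  operations. A bijection that commutes with \<open>g\<close> carries the solutions for \<open>x\<close> onto the solutions
  for its image \<open>f x\<close> (lemmas \<open>c_count_transfer\<close> and \<open>r_count_transfer\<close>). So corresponding
  elements contribute the same monomial, and reindexing the sum along the isomorphism identifies
  the two polynomials.
\<close>

text \<open>Closure of \<open>g\<close> lets injectivity of \<open>f\<close> on \<open>A\<close> reflect the fixed-point equation from \<open>B\<close>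
  back to \<open>A\<close>; the solution sets then correspond under \<open>f\<close>.\<close>

lemma c_count_transfer:
  assumes f: "bij_betw f A B"
    and closed: "\<And>a b. \<lbrakk>a \<in> A; b \<in> A\<rbrakk> \<Longrightarrow> g a b \<in> A"
    and hom: "\<And>a b. \<lbrakk>a \<in> A; b \<in> A\<rbrakk> \<Longrightarrow> f (g a b) = h (f a) (f b)"
    and x: "x \<in> A"
  shows "c_count B h (f x) = c_count A g x"
proof -
  have inj: "inj_on f A" and B: "B = f ` A"
    using f by (auto simp: bij_betw_def)
  have "h (f y) (f x) = f y \<longleftrightarrow> g y x = y" if "y \<in> A" for y
    using inj_on_eq_iff[OF inj closed[OF that x] that] hom[OF that x] by simp
  then have "{z \<in> B. h z (f x) = z} = f ` {y \<in> A. g y x = y}"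
    unfolding B by auto
  then show ?thesis
    unfolding c_count_def by (simp add: card_image inj_on_subset[OF inj])
qed

lemma r_count_transfer:
  assumes f: "bij_betw f A B"
    and closed: "\<And>a b. \<lbrakk>a \<in> A; b \<in> A\<rbrakk> \<Longrightarrow> g a b \<in> A"
    and hom: "\<And>a b. \<lbrakk>a \<in> A; b \<in> A\<rbrakk> \<Longrightarrow> f (g a b) = h (f a) (f b)"
    and x: "x \<in> A"
  shows "r_count B h (f x) = r_count A g x"
proof -
  have inj: "inj_on f A" and B: "B = f ` A"
    using f by (auto simp: bij_betw_def)
  have "h (f x) (f y) = f x \<longleftrightarrow> g x y = x" if "y \<in> A" for y
    using inj_on_eq_iff[OF inj closed[OF x that] x] hom[OF x that] by simp
  then have "{z \<in> B. h (f x) z = f x} = f ` {y \<in> A. g x y = x}"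
    unfolding B by auto
  then show ?thesis
    unfolding r_count_def by (simp add: card_image inj_on_subset[OF inj])
qed

theorem proposition6p2:
  fixes X :: "'a singquandle_struct" and Y :: "'b singquandle_struct"
  assumes "singquandle X" and "finite (carrier X)"
    and "singquandle Y" and "finite (carrier Y)"
    and "singquandle_isomorphic X Y"
  shows "sqp X = sqp Y"
proof -
  interpret X: singquandle X by fact
  obtain f where bij: "bij_betw f (carrier X) (carrier Y)" and hom: "f \<in> singquandle_hom X Y"
    using assms(5) unfolding singquandle_isomorphic_def singquandle_iso_def by blast
  have op: "f (quandle_op X a b) = quandle_op Y (f a) (f b)"
    and R1: "f (R1 X a b) = R1 Y (f a) (f b)"
    and R2: "f (R2 X a b) = R2 Y (f a) (f b)"
    if "a \<in> carrier X" "b \<in> carrier X" for a b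
    using hom that unfolding singquandle_hom_def by auto
  note counts =
    r_count_transfer[where g = "quandle_op X" and h = "quandle_op Y", OF bij X.op_closed op]
    c_count_transfer[where g = "quandle_op X" and h = "quandle_op Y", OF bij X.op_closed op]
    r_count_transfer[where g = "R1 X" and h = "R1 Y", OF bij X.R1_closed R1]
    c_count_transfer[where g = "R1 X" and h = "R1 Y", OF bij X.R1_closed R1]
    r_count_transfer[where g = "R2 X" and h = "R2 Y", OF bij X.R2_closed R2]
    c_count_transfer[where g = "R2 X" and h = "R2 Y", OF bij X.R2_closed R2]
  show ?thesis
    unfolding sqp_def sum.reindex_bij_betw[OF bij, symmetric]
    by (rule sum.cong) (simp_all add: counts)
qed

end
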